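(* Let $\langle\mathcal{K},\mathcal{L}\rangle$ be a free completion of MU-categories. The following conditions are equivalent for an $\mathcal{L}$-object $U$: (i) $U$ is an $\mathcal{L}$-limit of a Fraïssé sequence in $\mathcal{K}$; (ii) $U$ is cofinal and projective in $\langle\mathcal{K},\mathcal{L}\rangle$; (iii) $U$ is cofinal and homogeneous in $\langle\mathcal{K},\mathcal{L}\rangle$; (iv) $U$ is a Fraïssé object in $\mathcal{L}$. Moreover, such an object $U$ is unique up to isomorphism, and every $\mathcal{K}$-sequence with $\mathcal{L}$-limit $U$ is Fraïssé.
   Context: An $\infty$-metric is a metric allowed to take the value $\infty$. An MU-category is a category $\mathcal{K}$ with an $\infty$-metric $d$ on every hom-set such that (1) $d(g\circ f,h\circ f)\le d(g,h)$ for all $\mathcal{K}$-maps $f$ and all compatible $g,h$, and (2) for every $\mathcal{K}$-map $f$ and $\varepsilon>0$ there is $\delta>0$ such that for every object $W$ and all $g,h\colon W\to\mathrm{dom}(f)$, $d(g,h)<\delta$ implies $d(f\circ g,f\circ h)<\varepsilon$. It is locally complete if all the hom-spaces are complete. We write $f\approx_\varepsilon g$ for $d(f,g)<\varepsilon$. For MU-categories $\mathcal{K}\subseteq\mathcal{L}$, $\mathcal{K}$ is a (not necessarily full) subcategory with the restricted metrics. A sequence $\langle X_*,f_*\rangle$ in $\mathcal{K}$ (a $\mathcal{K}$-sequence) consists of $\mathcal{K}$-objects $X_n$ and $\mathcal{K}$-maps $f_n\colon X_{n+1}\to X_n$, $n\in\omega$; $f_{n,n'}=f_n\circ\cdots\circ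 f_{n'-1}\colon X_{n'}\to X_n$ for $n\le n'$. A limit $\langle X_\infty,f_{*,\infty}\rangle$ in $\mathcal{L}$ is a category-theoretic inverse limit with cone maps $f_{n,\infty}\colon X_\infty\to X_n$. Free completion. $\langle\mathcal{K},\mathcal{L}\rangle$, with $\mathcal{K}\subseteq\mathcal{L}$ MU-categories, is a free completion if: (L1) $\mathcal{L}$ is locally complete and every $\mathcal{K}$-sequence has a limit in $\mathcal{L}$. (L2) Every $\mathcal{L}$-object is a limit in $\mathcal{L}$ of a $\mathcal{K}$-sequence. (F1) For every $\mathcal{K}$-sequence $f_*$, every its limit $\langle X_\infty,f_{*,\infty}\rangle$ in $\mathcal{L}$, every $\mathcal{K}$-object $Y$, every $\varepsilon>0$, and every $\mathcal{L}$-map $h\colon X_\infty\to Y$ there is $n\in\omega$ and a $\mathcal{K}$-map $g\colon X_n\to Y$ such that $h\approx_\varepsilon g\circ f_{n,\infty}$. (F2) For every $\mathcal{K}$-object $Y$ and every $\varepsilon>0$ there is $\delta>0$ such that for every $\mathcal{K}$-sequence $f_*$, every its limit $\langle X_\infty,f_{*,\infty}\rangle$ in $\mathcal{L}$, every $n\in\omega$, and all $\mathcal{K}$-maps $g,g'\colon X_n\to Y$ with $g\circ f_{n,\infty}\approx_\delta g'\circ f_{n,\infty}$ there is $n'\ge n$ such that $g\circ f_{n,n'}\approx_\varepsilon g'\circ f_{n,n'}$. (C) For every $\mathcal{K}$-sequence $f_*$, every its limit $\langle X_\infty,f_{*,\infty}\rangle$ in $\mathcal{L}$, and every $\varepsilon>0$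 there is $n\in\omega$ and $\delta>0$ such that for all $\mathcal{L}$-maps $h,h'\colon Y\to X_\infty$ with $f_{n,\infty}\circ h\approx_\delta f_{n,\infty}\circ h'$ we have $h\approx_\varepsilon h'$. Properties of objects. An $\mathcal{L}$-object $U$ is: cofinal in $\langle\mathcal{K},\mathcal{L}\rangle$ if for every $\mathcal{K}$-object $X$ there is an $\mathcal{L}$-map $U\to X$; projective in $\langle\mathcal{K},\mathcal{L}\rangle$ if for every $\mathcal{K}$-object $X$, every $\varepsilon>0$, every $\mathcal{L}$-map $f\colon U\to X$ and every $\mathcal{K}$-map $g\colon Y\to X$ there is an $\mathcal{L}$-map $h\colon U\to Y$ with $f\approx_\varepsilon g\circ h$; homogeneous in $\langle\mathcal{K},\mathcal{L}\rangle$ if for every $\mathcal{K}$-object $X$, every $\varepsilon>0$, and all $\mathcal{L}$-maps $f,g\colon U\to X$ there is an $\mathcal{L}$-automorphism $h$ of $U$ with $f\approx_\varepsilon g\circ h$. "In $\mathcal{L}$" means "in $\langle\mathcal{L},\mathcal{L}\rangle$". A Fraïssé object in a locally complete MU-category $\mathcal{L}$ is an object that is cofinal and projective in $\mathcal{L}$; equivalently, cofinal and homogeneous in $\mathcal{L}$. Fraïssé sequence. A sequence $\langle X_*,f_*\rangle$ in $\mathcal{K}$ is Fraïssé if it is: cofinal (for every $\mathcal{K}$-object $Y$ there is $n$ and a $\mathcal{K}$-map $X_n\to Y$), absorbing (for every $n$, $\varepsilon>0$ and $\mathcal{K}$-map $f\colon Y\to X_n$ there is $n'\ge n$ and a $\mathcal{K}$-map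 $g\colon X_{n'}\to Y$ with $f\circ g\approx_\varepsilon f_{n,n'}$), and projective (for every $\varepsilon>0$ and $\mathcal{K}$-maps $f\colon X_n\to Z$, $g\colon Y\to Z$ there is $n'\ge n$ and a $\mathcal{K}$-map $g'\colon X_{n'}\to Y$ with $f\circ f_{n,n'}\approx_\varepsilon g\circ g'$). *)

theory Defs
  imports "HOL-Library.Extended_Nonnegative_Real"
begin

definition infty_metric_on :: "'a set \<Rightarrow> ('a \<Rightarrow> 'a \<Rightarrow> ennreal) \<Rightarrow> bool" where
  "infty_metric_on S d \<longleftrightarrow>
    (\<forall>x\<in>S. \<forall>y\<in>S. d x y = 0 \<longleftrightarrow> x = y) \<and>
    (\<forall>x\<in>S. \<forall>y\<in>S. d x y = d y x) \<and>
    (\<forall>x\<in>S. \<forall>y\<in>S. \<forall>z\<in>S. d x z \<le> d x y + d y z)"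

definition infty_complete_on :: "'a set \<Rightarrow> ('a \<Rightarrow> 'a \<Rightarrow> ennreal) \<Rightarrow> bool" where
  "infty_complete_on S d \<longleftrightarrow>
    (\<forall>\<sigma> :: nat \<Rightarrow> 'a.
      (\<forall>n. \<sigma> n \<in> S) \<and>
      (\<forall>\<epsilon>>0. \<exists>N. \<forall>m\<ge>N. \<forall>n\<ge>N. d (\<sigma> m) (\<sigma> n) < ennreal \<epsilon>) \<longrightarrow>
      (\<exists>l\<in>S. (\<lambda>n. d (\<sigma> n) l) \<longlonglongrightarrow> 0))"

text \<open>The composition \<open>g \<cdot> f\<close> is ``\<open>g\<close> after \<open>f\<close>''. All operations are total functions; only their
  values on objects, on composable maps, and (for \<open>Dist\<close>) on parallel maps matter.\<close>

record ('o, 'm) mucat =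
  Obj :: "'o set"
  Map :: "'m set"
  Dom :: "'m \<Rightarrow> 'o"
  Cod :: "'m \<Rightarrow> 'o"
  Ident :: "'o \<Rightarrow> 'm"
  Comp :: "'m \<Rightarrow> 'm \<Rightarrow> 'm"  (infixl "\<cdot>\<index>" 70)
  Dist :: "'m \<Rightarrow> 'm \<Rightarrow> ennreal"

definition hom :: "('o, 'm, 'z) mucat_scheme \<Rightarrow> 'o \<Rightarrow> 'o \<Rightarrow> 'm set" where
  "hom C X Y = {f \<in> Map C. Dom C f = X \<and> Cod C f = Y}"

definition approx :: "('o, 'm, 'z) mucat_scheme \<Rightarrow> real \<Rightarrow> 'm \<Rightarrow> 'm \<Rightarrow> bool" where
  "approx C \<epsilon> f g \<longleftrightarrow> Dist C f g < ennreal \<epsilon>"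

locale category =
  fixes C :: "('o, 'm) mucat" (structure)
  assumes dom_in_Obj: "f \<in> Map C \<Longrightarrow> Dom C f \<in> Obj C"
    and cod_in_Obj: "f \<in> Map C \<Longrightarrow> Cod C f \<in> Obj C"
    and ident_in_hom: "X \<in> Obj C \<Longrightarrow> Ident C X \<in> hom C X X"
    and comp_in_hom: "f \<in> hom C X Y \<Longrightarrow> g \<in> hom C Y Z \<Longrightarrow> g \<cdot> f \<in> hom C X Z"
    and comp_ident_right: "f \<in> hom C X Y \<Longrightarrow> f \<cdot> Ident C X = f"
    and comp_ident_left: "f \<in> hom C X Y \<Longrightarrow> Ident C Y \<cdot> f = f"
    and comp_assoc:
      "f \<in> hom C W X \<Longrightarrow> g \<in> hom C X Y \<Longrightarrow> h \<in> hom C Y Z \<Longrightarrow> (h \<cdot> g) \<cdot> f = h \<cdot> (g \<cdot> f)"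

locale MU_category = category C for C :: "('o, 'm) mucat" (structure) +
  assumes hom_infty_metric: "X \<in> Obj C \<Longrightarrow> Y \<in> Obj C \<Longrightarrow> infty_metric_on (hom C X Y) (Dist C)"
    and dist_precomp_le:
      "f \<in> hom C X Y \<Longrightarrow> g \<in> hom C Y Z \<Longrightarrow> h \<in> hom C Y Z \<Longrightarrow>
        Dist C (g \<cdot> f) (h \<cdot> f) \<le> Dist C g h"
    and postcomp_uniform:
      "f \<in> hom C X Y \<Longrightarrow> \<epsilon> > 0 \<Longrightarrow>
        \<exists>\<delta>>0. \<forall>W\<in>Obj C. \<forall>g\<in>hom C W X. \<forall>h\<in>hom C W X.
          approx C \<delta> g h \<longrightarrow> approx C \<epsilon> (f \<cdot> g) (f \<cdot> h)"

definition locally_complete :: "('o, 'm) mucat \<Rightarrow> bool" where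
  "locally_complete C \<longleftrightarrow>
    (\<forall>X\<in>Obj C. \<forall>Y\<in>Obj C. infty_complete_on (hom C X Y) (Dist C))"

definition is_iso :: "('o, 'm) mucat \<Rightarrow> 'm \<Rightarrow> 'o \<Rightarrow> 'o \<Rightarrow> bool" where
  "is_iso C f X Y \<longleftrightarrow>
    f \<in> hom C X Y \<and>
    (\<exists>g\<in>hom C Y X. Comp C g f = Ident C X \<and> Comp C f g = Ident C Y)"

definition isomorphic :: "('o, 'm) mucat \<Rightarrow> 'o \<Rightarrow> 'o \<Rightarrow> bool" where
  "isomorphic C X Y \<longleftrightarrow> (\<exists>f. is_iso C f X Y)"

definition automorphism :: "('o, 'm) mucat \<Rightarrow> 'o \<Rightarrow> 'm \<Rightarrow> bool" where
  "automorphism C X f \<longleftrightarrow> is_iso C f X X"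

locale MU_subcategory =
  K: MU_category K + L: MU_category L for K L :: "('o, 'm) mucat" +
  assumes Obj_subset: "Obj K \<subseteq> Obj L"
    and Map_subset: "Map K \<subseteq> Map L"
    and Dom_eq: "f \<in> Map K \<Longrightarrow> Dom K f = Dom L f"
    and Cod_eq: "f \<in> Map K \<Longrightarrow> Cod K f = Cod L f"
    and Ident_eq: "X \<in> Obj K \<Longrightarrow> Ident K X = Ident L X"
    and Comp_eq: "f \<in> hom K X Y \<Longrightarrow> g \<in> hom K Y Z \<Longrightarrow> Comp K g f = Comp L g f"
    and Dist_eq: "f \<in> hom K X Y \<Longrightarrow> g \<in> hom K X Y \<Longrightarrow> Dist K f g = Dist L f g"

definition is_sequence :: "('o, 'm) mucat \<Rightarrow> (nat \<Rightarrow> 'o) \<Rightarrow> (nat \<Rightarrow> 'm) \<Rightarrow> bool" where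
  "is_sequence C X f \<longleftrightarrow> (\<forall>n. X n \<in> Obj C) \<and> (\<forall>n. f n \<in> hom C (X (Suc n)) (X n))"

text \<open>For \<open>n \<le> m\<close>, \<open>seq_map C X f n m\<close> is the composite \<open>f n \<cdot> \<dots> \<cdot> f (m - 1)\<close> from \<open>X m\<close> to \<open>X n\<close>,
  the identity of \<open>X n\<close> if \<open>m = n\<close>. The value for \<open>m < n\<close> is a dummy and is never used.\<close>

primrec seq_map :: "('o, 'm) mucat \<Rightarrow> (nat \<Rightarrow> 'o) \<Rightarrow> (nat \<Rightarrow> 'm) \<Rightarrow> nat \<Rightarrow> nat \<Rightarrow> 'm" where
  "seq_map C X f n 0 = Ident C (X n)"
| "seq_map C X f n (Suc m) = (if n \<le> m then Comp C (seq_map C X f n m) (f m) else Ident C (X n))"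

definition is_cone ::
  "('o, 'm) mucat \<Rightarrow> (nat \<Rightarrow> 'o) \<Rightarrow> (nat \<Rightarrow> 'm) \<Rightarrow> 'o \<Rightarrow> (nat \<Rightarrow> 'm) \<Rightarrow> bool" where
  "is_cone C X f Y p \<longleftrightarrow>
    Y \<in> Obj C \<and> (\<forall>n. p n \<in> hom C Y (X n)) \<and> (\<forall>n. Comp C (f n) (p (Suc n)) = p n)"

definition is_limit ::
  "('o, 'm) mucat \<Rightarrow> (nat \<Rightarrow> 'o) \<Rightarrow> (nat \<Rightarrow> 'm) \<Rightarrow> 'o \<Rightarrow> (nat \<Rightarrow> 'm) \<Rightarrow> bool" where
  "is_limit C X f U p \<longleftrightarrow>
    is_cone C X f U p \<and>
    (\<forall>Y q. is_cone C X f Y q \<longrightarrow> (\<exists>!u. u \<in> hom C Y U \<and> (\<forall>n. Comp C (p n) u = q n)))"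

locale free_completion = MU_subcategory K L for K L :: "('o, 'm) mucat" +
  assumes L1_complete: "locally_complete L"
    and L1_limits: "is_sequence K X f \<Longrightarrow> \<exists>U p. is_limit L X f U p"
    and L2: "U \<in> Obj L \<Longrightarrow> \<exists>X f p. is_sequence K X f \<and> is_limit L X f U p"
    and F1: "is_sequence K X f \<Longrightarrow> is_limit L X f U p \<Longrightarrow> Y \<in> Obj K \<Longrightarrow> \<epsilon> > 0 \<Longrightarrow> h \<in> hom L U Y \<Longrightarrow>
        \<exists>n. \<exists>g\<in>hom K (X n) Y. approx L \<epsilon> h (Comp L g (p n))"
    and F2: "Y \<in> Obj K \<Longrightarrow> \<epsilon> > 0 \<Longrightarrow>
        \<exists>\<delta>>0. \<forall>X f U p n. is_sequence K X f \<longrightarrow> is_limit L X f U p \<longrightarrow>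
          (\<forall>g\<in>hom K (X n) Y. \<forall>g'\<in>hom K (X n) Y.
            approx L \<delta> (Comp L g (p n)) (Comp L g' (p n)) \<longrightarrow>
            (\<exists>n'\<ge>n. approx K \<epsilon> (Comp K g (seq_map K X f n n')) (Comp K g' (seq_map K X f n n'))))"
    and C: "is_sequence K X f \<Longrightarrow> is_limit L X f U p \<Longrightarrow> \<epsilon> > 0 \<Longrightarrow>
        \<exists>n. \<exists>\<delta>>0. \<forall>Y\<in>Obj L. \<forall>h\<in>hom L Y U. \<forall>h'\<in>hom L Y U.
          approx L \<delta> (Comp L (p n) h) (Comp L (p n) h') \<longrightarrow> approx L \<epsilon> h h'"

definition cofinal_in :: "('o, 'm) mucat \<Rightarrow> ('o, 'm) mucat \<Rightarrow> 'o \<Rightarrow> bool" where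
  "cofinal_in K L U \<longleftrightarrow> (\<forall>X\<in>Obj K. \<exists>f. f \<in> hom L U X)"

definition projective_in :: "('o, 'm) mucat \<Rightarrow> ('o, 'm) mucat \<Rightarrow> 'o \<Rightarrow> bool" where
  "projective_in K L U \<longleftrightarrow>
    (\<forall>X\<in>Obj K. \<forall>\<epsilon>>0. \<forall>f\<in>hom L U X. \<forall>Y\<in>Obj K. \<forall>g\<in>hom K Y X.
      \<exists>h\<in>hom L U Y. approx L \<epsilon> f (Comp L g h))"

definition homogeneous_in :: "('o, 'm) mucat \<Rightarrow> ('o, 'm) mucat \<Rightarrow> 'o \<Rightarrow> bool" where
  "homogeneous_in K L U \<longleftrightarrow>
    (\<forall>X\<in>Obj K. \<forall>\<epsilon>>0. \<forall>f\<in>hom L U X. \<forall>g\<in>hom L U X.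
      \<exists>h. automorphism L U h \<and> approx L \<epsilon> f (Comp L g h))"

definition Fraisse_object :: "('o, 'm) mucat \<Rightarrow> 'o \<Rightarrow> bool" where
  "Fraisse_object L U \<longleftrightarrow> U \<in> Obj L \<and> cofinal_in L L U \<and> projective_in L L U"

definition cofinal_seq :: "('o, 'm) mucat \<Rightarrow> (nat \<Rightarrow> 'o) \<Rightarrow> bool" where
  "cofinal_seq K X \<longleftrightarrow> (\<forall>Y\<in>Obj K. \<exists>n f. f \<in> hom K (X n) Y)"

definition absorbing_seq :: "('o, 'm) mucat \<Rightarrow> (nat \<Rightarrow> 'o) \<Rightarrow> (nat \<Rightarrow> 'm) \<Rightarrow> bool" where
  "absorbing_seq K X f \<longleftrightarrow>
    (\<forall>n. \<forall>\<epsilon>>0. \<forall>Y\<in>Obj K. \<forall>e\<in>hom K Y (X n).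
      \<exists>n'\<ge>n. \<exists>g\<in>hom K (X n') Y. approx K \<epsilon> (Comp K e g) (seq_map K X f n n'))"

definition projective_seq :: "('o, 'm) mucat \<Rightarrow> (nat \<Rightarrow> 'o) \<Rightarrow> (nat \<Rightarrow> 'm) \<Rightarrow> bool" where
  "projective_seq K X f \<longleftrightarrow>
    (\<forall>n. \<forall>\<epsilon>>0. \<forall>Y\<in>Obj K. \<forall>Z\<in>Obj K. \<forall>e\<in>hom K (X n) Z. \<forall>g\<in>hom K Y Z.
      \<exists>n'\<ge>n. \<exists>g'\<in>hom K (X n') Y. approx K \<epsilon> (Comp K e (seq_map K X f n n')) (Comp K g g'))"

definition Fraisse_sequence :: "('o, 'm) mucat \<Rightarrow> (nat \<Rightarrow> 'o) \<Rightarrow> (nat \<Rightarrow> 'm) \<Rightarrow> bool" where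
  "Fraisse_sequence K X f \<longleftrightarrow>
    is_sequence K X f \<and> cofinal_seq K X \<and> absorbing_seq K X f \<and> projective_seq K X f"

end

theory Submission
  imports Defs
begin

text \<open>
  Conditions (F1) and (F2) translate approximate factorizations of maps \<open>U \<rightarrow> X\<close> through a limit
  \<open>U\<close> into approximate factorizations inside the sequence; this gives (i) \<open>\<longleftrightarrow>\<close> (ii). An approximate
  lift \<open>U \<rightarrow> Y\<^sub>n\<close> along \<open>\<K>\<close>-maps can be improved step by step to an approximate cone over
  \<open>Y\<^sub>*\<close>, which by local completeness converges to a cone; together with (C) this extends projectivity
  from \<open>\<K>\<close> to \<open>\<L>\<close>. Finally, if \<open>U\<close> and \<open>V\<close> are projective in \<open>\<L>\<close>, every map \<open>U \<rightarrow> V\<close> is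
  approximated by isomorphisms, which gives both homogeneity and uniqueness.
\<close>

section \<open>Approximation and convergence of maps\<close>

lemma approx_pos: "approx C e f g \<Longrightarrow> e > 0"
  unfolding approx_def using ennreal_neg[of e] by (cases "e > 0") auto

lemma approx_mono: "approx C e f g \<Longrightarrow> e \<le> e' \<Longrightarrow> approx C e' f g"
  unfolding approx_def by (meson ennreal_leI order_less_le_trans)

text \<open>The real-valued \<epsilon> form lets limits be handled through \<open>approx\<close>
  alone; \<open>converges_iff_tendsto\<close> links it to the limits in
  \<open>infty_complete_on\<close>.\<close>

definition converges :: "('o, 'm) mucat \<Rightarrow> (nat \<Rightarrow> 'm) \<Rightarrow> 'm \<Rightarrow> bool" where
  "converges C \<sigma> l \<longleftrightarrow> (\<forall>e>0. \<forall>\<^sub>F n in sequentially. approx C e (\<sigma> n) l)"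

lemma convergesD: "converges C \<sigma> l \<Longrightarrow> e > 0 \<Longrightarrow> \<forall>\<^sub>F n in sequentially. approx C e (\<sigma> n) l"
  by (simp add: converges_def)

lemma converges_Suc: "converges C \<sigma> l \<Longrightarrow> converges C (\<lambda>n. \<sigma> (Suc n)) l"
  unfolding converges_def eventually_sequentially by (meson le_SucI)

lemma converges_iff_tendsto: "converges C \<sigma> l \<longleftrightarrow> (\<lambda>n. Dist C (\<sigma> n) l) \<longlonglongrightarrow> 0"
proof
  assume c: "converges C \<sigma> l"
  show "(\<lambda>n. Dist C (\<sigma> n) l) \<longlonglongrightarrow> 0"
  proof (rule order_tendstoI)
    fix a :: ennreal
    assume "0 < a"
    then obtain e where e: "0 < e" "ennreal e < a"
      by (metis dense ennreal_0 ennreal_cases ennreal_less_iff ennreal_top_neq_zero linorder_not_less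
          neq_top_trans order_less_imp_le top.not_eq_extremum le_less)
    then show "\<forall>\<^sub>F n in sequentially. Dist C (\<sigma> n) l < a"
      using convergesD[OF c e(1)] by (auto simp: approx_def elim!: eventually_mono)
  qed simp
next
  assume "(\<lambda>n. Dist C (\<sigma> n) l) \<longlonglongrightarrow> 0"
  then show "converges C \<sigma> l"
    unfolding converges_def approx_def by (simp add: order_tendstoD(2))
qed

lemma is_sequenceD:
  assumes "is_sequence C X f"
  shows "X n \<in> Obj C" "f n \<in> hom C (X (Suc n)) (X n)"
  using assms by (auto simp: is_sequence_def)

lemma is_coneD:
  assumes "is_cone C X f U p"
  shows "U \<in> Obj C" "p n \<in> hom C U (X n)" "Comp C (f n) (p (Suc n)) = p n"
  using assms by (auto simp: is_cone_def)

lemma is_limit_cone: "is_limit C X f U p \<Longrightarrow> is_cone C X f U p"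
  by (simp add: is_limit_def)

section \<open>Bonding maps of sequences and cones\<close>

context category
begin

lemma hom_Obj:
  assumes "f \<in> hom C X Y"
  shows "X \<in> Obj C" "Y \<in> Obj C"
  using assms dom_in_Obj cod_in_Obj by (auto simp: hom_def)

lemma seq_map_in_hom:
  assumes "is_sequence C X f" "n \<le> m"
  shows "seq_map C X f n m \<in> hom C (X m) (X n)"
  using assms(2)
proof (induction m)
  case (Suc m)
  then show ?case
    using ident_in_hom[OF is_sequenceD(1)[OF assms(1)]] comp_in_hom[OF is_sequenceD(2)[OF assms(1)]]
    by (cases "n = Suc m") auto
qed (use is_sequenceD[OF assms(1)] ident_in_hom in auto)

lemma seq_map_self: "seq_map C X f n n = Ident C (X n)"
  by (cases n) auto

lemma seq_map_step: "is_sequence C X f \<Longrightarrow> seq_map C X f n (Suc n) = f n"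
  using comp_ident_left[OF is_sequenceD(2)] by (simp add: seq_map_self)

lemma seq_map_comp:
  assumes "is_sequence C X f" "n \<le> m" "m \<le> k"
  shows "seq_map C X f n m \<cdot> seq_map C X f m k = seq_map C X f n k"
  using assms(3)
proof (induction k)
  case 0
  with assms show ?case
    using comp_ident_right[OF seq_map_in_hom[OF assms(1,2)]] by (simp add: seq_map_self)
next
  case (Suc k)
  show ?case
  proof (cases "m = Suc k")
    case True
    then show ?thesis
      using comp_ident_right[OF seq_map_in_hom[OF assms(1,2)]] by (simp add: seq_map_self del: seq_map.simps)
  next
    case False
    then have "m \<le> k" using Suc.prems by simp
    then show ?thesis
      using Suc.IH comp_assoc[OF is_sequenceD(2)[OF assms(1)] seq_map_in_hom[OF assms(1)]
          seq_map_in_hom[OF assms(1,2)], of k] assms(2) by auto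
  qed
qed

lemma seq_map_cone:
  assumes "is_sequence C X f" "is_cone C X f U p" "n \<le> m"
  shows "seq_map C X f n m \<cdot> p m = p n"
  using assms(3)
proof (induction m)
  case 0
  then show ?case
    using comp_ident_left[OF is_coneD(2)[OF assms(2)]] by (simp add: seq_map_self)
next
  case (Suc m)
  show ?case
  proof (cases "n = Suc m")
    case True
    then show ?thesis
      using comp_ident_left[OF is_coneD(2)[OF assms(2)]] by (simp add: seq_map_self del: seq_map.simps)
  next
    case False
    then have "n \<le> m" using Suc.prems by simp
    then show ?thesis
      using Suc.IH comp_assoc[OF is_coneD(2)[OF assms(2)] is_sequenceD(2)[OF assms(1)]
          seq_map_in_hom[OF assms(1)], of n m] is_coneD(3)[OF assms(2)] by auto
  qed
qed

end

section \<open>Metric calculus in an MU-category\<close>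

context MU_category
begin

lemma dist_eq_0_iff: "f \<in> hom C X Y \<Longrightarrow> g \<in> hom C X Y \<Longrightarrow> Dist C f g = 0 \<longleftrightarrow> f = g"
  using hom_infty_metric[of X Y] hom_Obj[of f X Y] by (simp add: infty_metric_on_def)

lemma dist_commute: "f \<in> hom C X Y \<Longrightarrow> g \<in> hom C X Y \<Longrightarrow> Dist C f g = Dist C g f"
  using hom_infty_metric[of X Y] hom_Obj[of f X Y] by (simp add: infty_metric_on_def)

lemma dist_triangle:
  "f \<in> hom C X Y \<Longrightarrow> g \<in> hom C X Y \<Longrightarrow> h \<in> hom C X Y \<Longrightarrow> Dist C f h \<le> Dist C f g + Dist C g h"
  using hom_infty_metric[of X Y] hom_Obj[of f X Y] by (simp add: infty_metric_on_def)

lemma approx_refl: "f \<in> hom C X Y \<Longrightarrow> e > 0 \<Longrightarrow> approx C e f f"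
  using dist_eq_0_iff[of f X Y f] by (simp add: approx_def)

lemma approx_sym: "f \<in> hom C X Y \<Longrightarrow> g \<in> hom C X Y \<Longrightarrow> approx C e f g \<Longrightarrow> approx C e g f"
  by (simp add: approx_def dist_commute)

lemma approx_trans:
  assumes "f \<in> hom C X Y" "g \<in> hom C X Y" "h \<in> hom C X Y" "approx C a f g" "approx C b g h"
  shows "approx C (a + b) f h"
proof -
  have "Dist C f g + Dist C g h < ennreal a + ennreal b"
    using assms(4,5) unfolding approx_def by (rule add_strict_mono)
  then show ?thesis
    using dist_triangle[OF assms(1-3)] approx_pos[OF assms(4)] approx_pos[OF assms(5)]
    unfolding approx_def by (simp add: ennreal_plus)
qed

lemma approx_trans_half:
  assumes "f \<in> hom C X Y" "g \<in> hom C X Y" "h \<in> hom C X Y"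
    "approx C (e/2) f g" "approx C (e/2) g h"
  shows "approx C e f h"
  using approx_trans[OF assms] by simp

lemma approx_precomp:
  "f \<in> hom C X Y \<Longrightarrow> g \<in> hom C Y Z \<Longrightarrow> h \<in> hom C Y Z \<Longrightarrow> approx C e g h \<Longrightarrow> approx C e (g \<cdot> f) (h \<cdot> f)"
  unfolding approx_def using dist_precomp_le order_le_less_trans by blast

lemma approx_imp_eq:
  assumes "f \<in> hom C X Y" "g \<in> hom C X Y" "\<And>e. e > 0 \<Longrightarrow> approx C e f g"
  shows "f = g"
proof -
  have "Dist C f g \<le> 0"
    by (rule ennreal_le_epsilon) (use assms(3) in \<open>auto simp: approx_def less_imp_le\<close>)
  then show ?thesis
    using dist_eq_0_iff[OF assms(1,2)] by simp
qed

lemma postcomp_modulus: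
  assumes "f \<in> hom C X Y" "e > 0"
  obtains d where "d > 0"
    "\<And>W g h. g \<in> hom C W X \<Longrightarrow> h \<in> hom C W X \<Longrightarrow> approx C d g h \<Longrightarrow> approx C e (f \<cdot> g) (f \<cdot> h)"
proof -
  from postcomp_uniform[OF assms] obtain d where "d > 0" and d: "\<forall>W\<in>Obj C. \<forall>g\<in>hom C W X. \<forall>h\<in>hom C W X.
      approx C d g h \<longrightarrow> approx C e (f \<cdot> g) (f \<cdot> h)"
    by (elim exE conjE)
  show thesis
    by (rule that[OF \<open>d > 0\<close>]) (rule d[rule_format, OF hom_Obj(1)])
qed

lemma converges_unique:
  assumes "\<And>n. \<sigma> n \<in> hom C X Y" "l \<in> hom C X Y" "l' \<in> hom C X Y" "converges C \<sigma> l" "converges C \<sigma> l'"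
  shows "l = l'"
proof (rule approx_imp_eq[OF assms(2,3)])
  fix e :: real
  assume "e > 0"
  then have "e / 2 > 0" by simp
  from eventually_conj[OF convergesD[OF assms(4) this] convergesD[OF assms(5) this]]
  obtain n where "approx C (e/2) (\<sigma> n) l" "approx C (e/2) (\<sigma> n) l'"
    by (auto dest: eventually_happens)
  then show "approx C e l l'"
    by (meson approx_sym approx_trans_half assms(1-3))
qed

lemma converges_postcomp:
  assumes "f \<in> hom C Y Z" "\<And>n. \<sigma> n \<in> hom C X Y" "l \<in> hom C X Y" "converges C \<sigma> l"
  shows "converges C (\<lambda>n. f \<cdot> \<sigma> n) (f \<cdot> l)"
  unfolding converges_def
proof (intro allI impI)
  fix e :: real
  assume "e > 0"
  with assms(1) obtain d where "d > 0"
    and d: "\<And>W g h. g \<in> hom C W Y \<Longrightarrow> h \<in> hom C W Y \<Longrightarrow> approx C d g h \<Longrightarrow> approx C e (f \<cdot> g) (f \<cdot> h)"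
    by (rule postcomp_modulus) auto
  then show "\<forall>\<^sub>F n in sequentially. approx C e (f \<cdot> \<sigma> n) (f \<cdot> l)"
    using convergesD[OF assms(4)] assms(2,3) by (blast intro: eventually_mono)
qed

text \<open>Precomposition is nonexpansive, so \<open>\<sigma>\<close> and \<open>\<tau>\<close> may vary simultaneously once composition
  with the limit \<open>l\<close> is known to be continuous.\<close>

lemma converges_comp:
  assumes "\<And>n. \<tau> n \<in> hom C X Y" "m \<in> hom C X Y" "converges C \<tau> m"
    and "\<And>n. \<sigma> n \<in> hom C Y Z" "l \<in> hom C Y Z" "converges C \<sigma> l"
  shows "converges C (\<lambda>n. \<sigma> n \<cdot> \<tau> n) (l \<cdot> m)"
  unfolding converges_def
proof (intro allI impI)
  fix e :: real
  assume "e > 0"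
  then have e: "e / 2 > 0" by simp
  show "\<forall>\<^sub>F n in sequentially. approx C e (\<sigma> n \<cdot> \<tau> n) (l \<cdot> m)"
    using convergesD[OF assms(6) e] convergesD[OF converges_postcomp[OF assms(5,1,2,3)] e]
  proof eventually_elim
    case (elim n)
    show ?case
      by (rule approx_trans_half[OF comp_in_hom[OF assms(1,4)] comp_in_hom[OF assms(1,5)]
            comp_in_hom[OF assms(2,5)] approx_precomp[OF assms(1,4,5) elim(1)] elim(2)])
  qed
qed

section \<open>Summable steps and approximate cones\<close>

text \<open>From stage \<open>n\<close> on, the steps add up to at most \<open>e * (1/2)^n\<close>,
  so the sequence is Cauchy. The bound by \<open>e\<close> is not strict, because strictness may be
  lost in the limit.\<close>

lemma complete_geometric:
  assumes "locally_complete C" "\<And>n. \<sigma> n \<in> hom C X Y" "e > 0"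
    and step: "\<And>n. approx C (e * (1/2) ^ Suc n) (\<sigma> n) (\<sigma> (Suc n))"
  obtains l where "l \<in> hom C X Y" "converges C \<sigma> l" "Dist C (\<sigma> 0) l \<le> ennreal e"
proof -
  \<comment> \<open>The factor \<open>1 - (1/2)^k\<close> is the exact partial geometric sum, so the
    induction closes without loss.\<close>
  have partial: "Dist C (\<sigma> n) (\<sigma> (n + k)) \<le> ennreal (e * (1/2)^n * (1 - (1/2)^k))" for n k
  proof (induction k)
    case 0
    then show ?case using dist_eq_0_iff[OF assms(2) assms(2)] by simp
  next
    case (Suc k)
    have "Dist C (\<sigma> n) (\<sigma> (n + Suc k)) \<le> Dist C (\<sigma> n) (\<sigma> (n + k)) + Dist C (\<sigma> (n + k)) (\<sigma> (n + Suc k))"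
      by (rule dist_triangle[OF assms(2) assms(2) assms(2)])
    also have "\<dots> \<le> ennreal (e * (1/2)^n * (1 - (1/2)^k)) + ennreal (e * (1/2) ^ Suc (n + k))"
      by (intro add_mono Suc.IH) (use step[of "n + k"] in \<open>simp add: approx_def less_imp_le\<close>)
    also have "\<dots> = ennreal (e * (1/2)^n * (1 - (1/2)^k) + e * (1/2) ^ Suc (n + k))"
      using assms(3) by (intro ennreal_plus[symmetric]) (auto intro!: mult_nonneg_nonneg simp: power_le_one)
    also have "e * (1/2)^n * (1 - (1/2)^k) + e * (1/2) ^ Suc (n + k) = e * (1/2)^n * (1 - (1/2)^Suc k)"
      by (simp add: power_add algebra_simps)
    finally show ?case .
  qed
  have tail: "Dist C (\<sigma> n) (\<sigma> m) \<le> ennreal (e * (1/2)^n)" if "n \<le> m" for n m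
  proof -
    have "Dist C (\<sigma> n) (\<sigma> m) \<le> ennreal (e * (1/2)^n * (1 - (1/2)^(m - n)))"
      using partial[of n "m - n"] that by simp
    also have "\<dots> \<le> ennreal (e * (1/2)^n)"
      using assms(3) by (intro ennreal_leI) (simp add: mult_le_cancel_left1)
    finally show ?thesis .
  qed
  have cauchy: "\<exists>N. \<forall>m\<ge>N. \<forall>n\<ge>N. Dist C (\<sigma> m) (\<sigma> n) < ennreal r" if "r > 0" for r
  proof -
    \<comment> \<open>\<open>N\<close> makes the tail smaller than \<open>r / 2\<close>; later terms
      are then compared through \<open>\<sigma> N\<close>.\<close>
    have "\<exists>N. (1/2)^N < r / (2 * e)"
      by (rule real_arch_pow_inv) (use that assms(3) in simp_all)
    then obtain N where N: "(1/2)^N < r / (2 * e)" ..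
    then have N: "e * (1/2)^N < r / 2"
      using assms(3) by (simp add: field_simps)
    have near: "approx C (r/2) (\<sigma> N) (\<sigma> m)" if "N \<le> m" for m
      unfolding approx_def
      by (rule order_le_less_trans[OF tail[OF that]]) (use N assms(3) in \<open>simp add: ennreal_less_iff\<close>)
    have "approx C r (\<sigma> m) (\<sigma> n)" if "N \<le> m" "N \<le> n" for m n
      by (rule approx_trans_half[OF assms(2) assms(2) assms(2) approx_sym[OF assms(2) assms(2) near] near])
        (use that in auto)
    then show ?thesis by (auto simp: approx_def)
  qed
  have "infty_complete_on (hom C X Y) (Dist C)"
    using assms(1) hom_Obj[OF assms(2)] unfolding locally_complete_def by blast
  then obtain l where l: "l \<in> hom C X Y" "(\<lambda>n. Dist C (\<sigma> n) l) \<longlonglongrightarrow> 0"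
    unfolding infty_complete_on_def using assms(2) cauchy by metis
  then have conv: "converges C \<sigma> l" by (simp add: converges_iff_tendsto)
  have "Dist C (\<sigma> 0) l \<le> ennreal e"
  proof (rule ennreal_le_epsilon)
    fix r :: real
    assume "r > 0"
    then obtain n where n: "approx C r (\<sigma> n) l"
      using eventually_happens[OF convergesD[OF conv]] by auto
    have "Dist C (\<sigma> 0) l \<le> Dist C (\<sigma> 0) (\<sigma> n) + Dist C (\<sigma> n) l"
      by (rule dist_triangle[OF assms(2) assms(2) l(1)])
    also have "\<dots> \<le> ennreal e + ennreal r"
      using tail[of 0 n] n by (intro add_mono) (auto simp: approx_def)
    finally show "Dist C (\<sigma> 0) l \<le> ennreal e + ennreal r" .
  qed
  with l conv that show ?thesis by blast
qed

text \<open>Only finitely many \<open>k \<le> j\<close> compete, so the minimum of their moduli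
  serves all of them. It is independent of \<open>W\<close> and of the maps, which lets
  \<open>approximate_cone\<close> fix its tolerances in advance.\<close>

lemma seq_map_common_modulus:
  assumes seq: "is_sequence C X f" and "e > 0"
  shows "\<exists>d>0. \<forall>k\<le>j. \<forall>W. \<forall>g\<in>hom C W (X j). \<forall>h\<in>hom C W (X j).
    approx C d g h \<longrightarrow> approx C e (seq_map C X f k j \<cdot> g) (seq_map C X f k j \<cdot> h)"
proof -
  have "\<exists>d>0. \<forall>W. \<forall>g\<in>hom C W (X j). \<forall>h\<in>hom C W (X j).
    approx C d g h \<longrightarrow> approx C e (seq_map C X f k j \<cdot> g) (seq_map C X f k j \<cdot> h)" if "k \<le> j" for k
    using postcomp_modulus[OF seq_map_in_hom[OF seq that] assms(2)] by metis
  then obtain D where D: "\<And>k. k \<le> j \<Longrightarrow> D k > 0" "\<And>k W g h. k \<le> j \<Longrightarrow> g \<in> hom C W (X j) \<Longrightarrow>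
    h \<in> hom C W (X j) \<Longrightarrow> approx C (D k) g h \<Longrightarrow> approx C e (seq_map C X f k j \<cdot> g) (seq_map C X f k j \<cdot> h)"
    by metis
  define d where "d = Min (D ` {..j})"
  have "d > 0" using D(1) by (auto simp: d_def)
  moreover have "d \<le> D k" if "k \<le> j" for k using that by (auto simp: d_def)
  ultimately show ?thesis
    by (intro exI[of _ d] conjI allI ballI impI D(2)) (auto intro: approx_mono)
qed

text \<open>Pushing the maps \<open>h j\<close> down to a fixed level gives a Cauchy sequence there;
  the limits commute exactly with the bonding maps and hence factor through \<open>V\<close>. The
  tolerances are fixed before \<open>W\<close> and \<open>h\<close>.\<close>

lemma approximate_cone:
  assumes comp: "locally_complete C" and seq: "is_sequence C X f" and lim: "is_limit C X f V q"
    and "e > 0"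
  shows "\<exists>\<delta> :: nat \<Rightarrow> real. (\<forall>j. \<delta> j > 0) \<and>
    (\<forall>W h. (\<forall>j. h j \<in> hom C W (X j)) \<longrightarrow> (\<forall>j. approx C (\<delta> j) (h j) (f j \<cdot> h (Suc j))) \<longrightarrow>
      (\<exists>u\<in>hom C W V. \<forall>j. approx C e (h j) (q j \<cdot> u)))"
proof -
  \<comment> \<open>These errors sum to \<open>e / 2\<close>, which leaves room for the strict bound
    by \<open>e\<close> at the end.\<close>
  define r where "r j = e / 2 * (1/2) ^ Suc j" for j
  have r: "r j > 0" for j using assms(4) by (simp add: r_def)
  let ?s = "seq_map C X f"
  have "\<exists>\<delta>. \<forall>j. \<delta> j > 0 \<and> (\<forall>k\<le>j. \<forall>W. \<forall>g\<in>hom C W (X j). \<forall>h\<in>hom C W (X j).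
      approx C (\<delta> j) g h \<longrightarrow> approx C (r j) (?s k j \<cdot> g) (?s k j \<cdot> h))"
    by (intro choice allI seq_map_common_modulus[OF seq r])
  then obtain \<delta> where \<delta>': "\<forall>j. \<delta> j > 0 \<and> (\<forall>k\<le>j. \<forall>W. \<forall>g\<in>hom C W (X j). \<forall>h\<in>hom C W (X j).
      approx C (\<delta> j) g h \<longrightarrow> approx C (r j) (?s k j \<cdot> g) (?s k j \<cdot> h))" ..
  have \<delta>: "\<delta> j > 0" "k \<le> j \<Longrightarrow> g \<in> hom C W (X j) \<Longrightarrow> h \<in> hom C W (X j) \<Longrightarrow>
     approx C (\<delta> j) g h \<Longrightarrow> approx C (r j) (?s k j \<cdot> g) (?s k j \<cdot> h)" for j k W g h
    using \<delta>' by auto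
  show ?thesis
  proof (intro exI[of _ \<delta>] conjI allI impI \<delta>(1))
    fix W h
    assume "\<forall>j. h j \<in> hom C W (X j)" "\<forall>j. approx C (\<delta> j) (h j) (f j \<cdot> h (Suc j))"
    then have h: "\<And>j. h j \<in> hom C W (X j)" and app: "\<And>j. approx C (\<delta> j) (h j) (f j \<cdot> h (Suc j))"
      by auto
    define \<sigma> where "\<sigma> k i = ?s k (k + i) \<cdot> h (k + i)" for k i
    have \<sigma>: "\<sigma> k i \<in> hom C W (X k)" for k i
      unfolding \<sigma>_def by (rule comp_in_hom[OF h seq_map_in_hom[OF seq]]) simp
    have \<sigma>_0: "\<sigma> k 0 = h k" for k
      unfolding \<sigma>_def using comp_ident_left[OF h] by (simp add: seq_map_self)
    \<comment> \<open>Passing from \<open>i\<close> to \<open>Suc i\<close> inserts the defect of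
      the cone at level \<open>k + i\<close>, which costs \<open>r (k + i)\<close>. For fixed
      \<open>k\<close> these costs form a geometric series with sum
      \<open>e / 2 * (1/2)^k\<close>.\<close>
    have step: "approx C (e / 2 * (1/2)^k * (1/2)^Suc i) (\<sigma> k i) (\<sigma> k (Suc i))" for k i
    proof -
      have "\<sigma> k (Suc i) = ?s k (k + i) \<cdot> (f (k + i) \<cdot> h (Suc (k + i)))"
        unfolding \<sigma>_def
        using comp_assoc[OF h is_sequenceD(2)[OF seq] seq_map_in_hom[OF seq], of k "k + i"] by simp
      moreover have "r (k + i) = e / 2 * (1/2)^k * (1/2)^Suc i"
        by (simp add: r_def power_add)
      ultimately show ?thesis
        using \<delta>(2)[OF _ h comp_in_hom[OF h is_sequenceD(2)[OF seq]] app, of k "k + i"]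
        by (simp only: \<sigma>_def le_add1)
    qed
    have "\<exists>l. l \<in> hom C W (X k) \<and> converges C (\<sigma> k) l \<and> Dist C (\<sigma> k 0) l \<le> ennreal (e / 2 * (1/2)^k)" for k
    proof -
      have "e / 2 * (1/2)^k > 0" using assms(4) by simp
      from complete_geometric[where \<sigma> = "\<sigma> k", OF comp \<sigma> this step] show ?thesis by blast
    qed
    then obtain l where l: "\<And>k. l k \<in> hom C W (X k)" "\<And>k. converges C (\<sigma> k) (l k)"
      "\<And>k. Dist C (\<sigma> k 0) (l k) \<le> ennreal (e / 2 * (1/2)^k)"
      by metis
    \<comment> \<open>Applying \<open>f k\<close> to \<open>\<sigma> (Suc k)\<close> gives
      \<open>\<sigma> k\<close> shifted by one index, so both sides are limits of one
      sequence.\<close>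
    have "f k \<cdot> l (Suc k) = l k" for k
    proof (rule converges_unique)
      have "f k \<cdot> \<sigma> (Suc k) i = \<sigma> k (Suc i)" for i
        unfolding \<sigma>_def
        using comp_assoc[OF h seq_map_in_hom[OF seq] is_sequenceD(2)[OF seq], of k "Suc k + i"]
          seq_map_comp[OF seq, of k "Suc k" "Suc k + i"] seq_map_step[OF seq]
        by (simp del: seq_map.simps)
      then show "converges C (\<lambda>i. \<sigma> k (Suc i)) (f k \<cdot> l (Suc k))"
        using converges_postcomp[OF is_sequenceD(2)[OF seq] \<sigma> l(1,2), of k] by simp
      show "converges C (\<lambda>i. \<sigma> k (Suc i)) (l k)"
        by (rule converges_Suc[OF l(2)])
    qed (use \<sigma> l comp_in_hom[OF l(1) is_sequenceD(2)[OF seq]] in auto)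
    then have "is_cone C X f W l"
      using l(1) hom_Obj(1)[OF h] by (auto simp: is_cone_def)
    then obtain u where u: "u \<in> hom C W V" "\<And>k. q k \<cdot> u = l k"
      using lim unfolding is_limit_def by metis
    have "approx C e (h k) (l k)" for k
    proof -
      have "Dist C (h k) (l k) \<le> ennreal (e / 2 * (1/2)^k)"
        using l(3)[of k] by (simp add: \<sigma>_0)
      also have "\<dots> \<le> ennreal (e / 2)"
        using assms(4) by (intro ennreal_leI) (simp add: mult_le_cancel_left1 power_le_one)
      also have "\<dots> < ennreal e"
        using assms(4) by (simp add: ennreal_less_iff)
      finally show ?thesis by (simp add: approx_def)
    qed
    with u show "\<exists>u\<in>hom C W V. \<forall>j. approx C e (h j) (q j \<cdot> u)" by metis
  qed
qed

section \<open>Isomorphisms from approximate inverses\<close>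

text \<open>Projectivity turns any \<open>h : U \<rightarrow> V\<close> into an approximate inverse \<open>h'\<close> on one side, then \<open>h'\<close>
  into an approximate inverse \<open>h\<^sub>1\<close> on the other side. Since \<open>h h' h\<^sub>1\<close> is close to both \<open>h\<close> and \<open>h\<^sub>1\<close>,
  the alternating sequences are Cauchy.\<close>

lemma projective_approx_iso:
  assumes comp: "locally_complete C" and U: "projective_in C C U" and V: "projective_in C C V"
    and h0: "h0 \<in> hom C U V" and "e > 0"
  shows "\<exists>h. is_iso C h U V \<and> approx C e h0 h"
proof -
  note Obj = hom_Obj[OF h0]
  \<comment> \<open>An approximate right inverse of \<open>a\<close> is a lift of the identity of
    \<open>B\<close> along \<open>a\<close>.\<close>
  have inv: "\<exists>b\<in>hom C B A. approx C d (Ident C B) (a \<cdot> b)"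
    if "projective_in C C B" "a \<in> hom C A B" "d > 0" for A B a d
    using that ident_in_hom hom_Obj unfolding projective_in_def by blast
  define r where "r k = e / 2 * (1/2) ^ Suc k" for k
  have r: "r k > 0" for k using assms(5) by (simp add: r_def)
  \<comment> \<open>\<open>?P\<close> is the invariant of stage \<open>k\<close>, with stage 0 tied
    to \<open>h0\<close>; \<open>?Q\<close> relates consecutive stages. The invariant carries
    \<open>r k / 2\<close> because comparing consecutive maps costs twice that amount.\<close>
  let ?P = "\<lambda>k (h, h'). h \<in> hom C U V \<and> h' \<in> hom C V U \<and> approx C (r k / 2) (Ident C V) (h \<cdot> h')
    \<and> (k = 0 \<longrightarrow> h = h0)"
  let ?Q = "\<lambda>k (h, h') (h1, h1'). approx C (r k) h h1 \<and> approx C (r k) h' h1' \<and>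
    approx C (r k) (Ident C U) (h' \<cdot> h1)"
  \<comment> \<open>Take \<open>b1\<close> to be a right inverse of \<open>a\<close> up to
    \<open>min d d'\<close>. Then \<open>b \<cdot> (a \<cdot> b1)\<close> is near \<open>b\<close>
    by continuity of postcomposition with \<open>b\<close>, and near \<open>b1\<close> because
    \<open>b \<cdot> a\<close> is near the identity.\<close>
  have move: "\<exists>b1\<in>hom C A B. approx C d (Ident C A) (a \<cdot> b1) \<and> approx C s b b1"
    if A: "projective_in C C A" and a: "a \<in> hom C B A" and b: "b \<in> hom C A B"
      and ba: "approx C (s / 2) (Ident C B) (b \<cdot> a)" and "d > 0" for A B a b s d
  proof -
    note s = approx_pos[OF ba]
    obtain d' where "d' > 0" and d': "\<And>W g h. g \<in> hom C W A \<Longrightarrow> h \<in> hom C W A \<Longrightarrow> approx C d' g h \<Longrightarrow>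
        approx C (s / 2) (b \<cdot> g) (b \<cdot> h)"
      using postcomp_modulus[OF b s] by metis
    then obtain b1 where b1: "b1 \<in> hom C A B" and ab1: "approx C (min d d') (Ident C A) (a \<cdot> b1)"
      using inv[OF A a, of "min d d'"] \<open>d > 0\<close> by auto
    note idA = ident_in_hom[OF hom_Obj(1)[OF b]] and idB = ident_in_hom[OF hom_Obj(2)[OF b]]
    have "approx C (s / 2) (b \<cdot> Ident C A) (b \<cdot> (a \<cdot> b1))"
      by (rule d'[OF idA comp_in_hom[OF b1 a] approx_mono[OF ab1]]) simp
    moreover have "approx C (s / 2) (Ident C B \<cdot> b1) ((b \<cdot> a) \<cdot> b1)"
      by (rule approx_precomp[OF b1 idB comp_in_hom[OF a b] ba])
    ultimately have "approx C (s / 2) b (b \<cdot> (a \<cdot> b1))" "approx C (s / 2) b1 (b \<cdot> (a \<cdot> b1))"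
      using comp_assoc[OF b1 a b] comp_ident_left[OF b1] comp_ident_right[OF b] by simp_all
    moreover note bab1 = comp_in_hom[OF comp_in_hom[OF b1 a] b]
    ultimately have "approx C s b b1"
      using approx_trans_half[OF b bab1 b1] approx_sym[OF b1 bab1] by blast
    moreover have "approx C d (Ident C A) (a \<cdot> b1)"
      using ab1 by (rule approx_mono) simp
    ultimately show ?thesis using b1 by blast
  qed
  have init: "\<exists>x. ?P 0 x"
  proof -
    obtain b where "b \<in> hom C V U" "approx C (r 0 / 2) (Ident C V) (h0 \<cdot> b)"
      using inv[OF V h0, of "r 0 / 2"] r[of 0] by auto
    with h0 show ?thesis by (intro exI[of _ "(h0, b)"]) simp
  qed
  have step: "\<exists>y. ?P (Suc k) y \<and> ?Q k x y" if Px: "?P k x" for x k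
  proof -
    obtain h h' where x: "x = (h, h')" by force
    have h: "h \<in> hom C U V" "h' \<in> hom C V U" "approx C (r k / 2) (Ident C V) (h \<cdot> h')"
      using Px x by auto
    \<comment> \<open>\<open>move\<close> is applied twice with \<open>U\<close> and
      \<open>V\<close> exchanged: \<open>h\<close> is replaced by a right inverse \<open>h1\<close>
      of \<open>h'\<close>, then \<open>h'\<close> by a right inverse \<open>h1'\<close> of
      \<open>h1\<close>.\<close>
    obtain h1 where h1: "h1 \<in> hom C U V" "approx C (r k / 2) (Ident C U) (h' \<cdot> h1)" "approx C (r k) h h1"
      using move[OF U h(2,1,3), of "r k / 2"] r[of k] by auto
    obtain h1' where h1': "h1' \<in> hom C V U" "approx C (r (Suc k) / 2) (Ident C V) (h1 \<cdot> h1')" "approx C (r k) h' h1'"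
      using move[OF V h1(1) h(2) h1(2), of "r (Suc k) / 2"] r[of "Suc k"] by auto
    have "approx C (r k) (Ident C U) (h' \<cdot> h1)"
      using approx_mono[OF h1(2)] r[of k] by simp
    with x h1 h1' show ?thesis by (intro exI[of _ "(h1, h1')"]) auto
  qed
  have "\<exists>F. \<forall>k. ?P k (F k) \<and> ?Q k (F k) (F (Suc k))"
    by (rule dependent_nat_choice[OF init step])
  then obtain F where F': "\<forall>k. ?P k (F k) \<and> ?Q k (F k) (F (Suc k))" ..
  note F = F'[THEN spec, THEN conjunct1] F'[THEN spec, THEN conjunct2]
  define h h' where "h k = fst (F k)" and "h' k = snd (F k)" for k
  have h: "h k \<in> hom C U V" "h' k \<in> hom C V U" "approx C (r k / 2) (Ident C V) (h k \<cdot> h' k)"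
    "approx C (r k) (h k) (h (Suc k))" "approx C (r k) (h' k) (h' (Suc k))"
    "approx C (r k) (Ident C U) (h' k \<cdot> h (Suc k))" for k
    using F(1)[of k] F(2)[of k] by (auto simp: h_def h'_def split_beta)
  have h_0: "h 0 = h0" using F(1)[of 0] by (auto simp: h_def split_beta)
  have e2: "e / 2 > 0" using assms(5) by simp
  obtain l where l: "l \<in> hom C U V" "converges C h l" "Dist C (h 0) l \<le> ennreal (e / 2)"
    by (rule complete_geometric[where \<sigma> = h, OF comp h(1) e2 h(4)[unfolded r_def]])
  obtain l' where l': "l' \<in> hom C V U" "converges C h' l'"
    by (rule complete_geometric[where \<sigma> = h', OF comp h(2) e2 h(5)[unfolded r_def]])
  have "r \<longlonglongrightarrow> e / 2 * 0"
    unfolding r_def by (intro tendsto_mult tendsto_const LIMSEQ_Suc LIMSEQ_power_zero) simp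
  then have small: "\<forall>\<^sub>F k in sequentially. r k < s" if "s > 0" for s
    using that by (simp add: order_tendstoD(2))
  have "l \<cdot> l' = Ident C V"
  proof (rule converges_unique[OF comp_in_hom[OF h(2,1)] comp_in_hom[OF l'(1) l(1)] ident_in_hom[OF Obj(2)]])
    show "converges C (\<lambda>k. h k \<cdot> h' k) (l \<cdot> l')"
      by (rule converges_comp[OF h(2) l' h(1) l(1,2)])
    show "converges C (\<lambda>k. h k \<cdot> h' k) (Ident C V)"
      unfolding converges_def
    proof (intro allI impI)
      fix s :: real
      assume "s > 0"
      from small[OF this] show "\<forall>\<^sub>F k in sequentially. approx C s (h k \<cdot> h' k) (Ident C V)"
      proof eventually_elim
        case (elim k)
        then have "approx C s (Ident C V) (h k \<cdot> h' k)"
          using approx_mono[OF h(3)] r[of k] by simp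
        then show ?case
          by (rule approx_sym[OF ident_in_hom[OF Obj(2)] comp_in_hom[OF h(2,1)]])
      qed
    qed
  qed
  moreover have "l' \<cdot> l = Ident C U"
  proof (rule converges_unique[OF comp_in_hom[OF h(1,2)] comp_in_hom[OF l(1) l'(1)] ident_in_hom[OF Obj(1)]])
    \<comment> \<open>The shifted index matters: \<open>h (Suc k)\<close> was chosen as a right
      inverse of \<open>h' k\<close>.\<close>
    show "converges C (\<lambda>k. h' k \<cdot> h (Suc k)) (l' \<cdot> l)"
      by (rule converges_comp[OF h(1) l(1) converges_Suc[OF l(2)] h(2) l'])
    show "converges C (\<lambda>k. h' k \<cdot> h (Suc k)) (Ident C U)"
      unfolding converges_def
    proof (intro allI impI)
      fix s :: real
      assume "s > 0"
      from small[OF this] show "\<forall>\<^sub>F k in sequentially. approx C s (h' k \<cdot> h (Suc k)) (Ident C U)"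
      proof eventually_elim
        case (elim k)
        then have "approx C s (Ident C U) (h' k \<cdot> h (Suc k))"
          using approx_mono[OF h(6)] by simp
        then show ?case
          by (rule approx_sym[OF ident_in_hom[OF Obj(1)] comp_in_hom[OF h(1,2)]])
      qed
    qed
  qed
  ultimately have "is_iso C l U V"
    using l(1) l'(1) by (auto simp: is_iso_def)
  moreover have "approx C e h0 l"
    unfolding approx_def h_0[symmetric]
    by (rule order_le_less_trans[OF l(3)]) (use assms(5) in \<open>simp add: ennreal_less_iff\<close>)
  ultimately show ?thesis by blast
qed

end

section \<open>Transfer from the subcategory to the ambient category\<close>

context MU_subcategory
begin

lemma hom_K_L: "f \<in> hom K X Y \<Longrightarrow> f \<in> hom L X Y"
  using Map_subset Dom_eq Cod_eq by (auto simp: hom_def)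

lemma is_sequence_K_L: "is_sequence K X f \<Longrightarrow> is_sequence L X f"
  using Obj_subset hom_K_L unfolding is_sequence_def by blast

lemma seq_map_K_L:
  assumes "is_sequence K X f"
  shows "seq_map K X f n m = seq_map L X f n m"
proof (induction m)
  case (Suc m)
  then show ?case
    using Comp_eq[OF is_sequenceD(2)[OF assms] K.seq_map_in_hom[OF assms], of n m]
      Ident_eq is_sequenceD(1)[OF assms]
    by auto
qed (use Ident_eq is_sequenceD(1)[OF assms] in auto)

lemma approx_K_L: "f \<in> hom K X Y \<Longrightarrow> g \<in> hom K X Y \<Longrightarrow> approx K e f g \<longleftrightarrow> approx L e f g"
  by (simp add: approx_def Dist_eq)

end

section \<open>Fraisse sequences and their limits\<close>

context free_completion
begin

text \<open>A factorization through stage \<open>n\<close> moves to any later stage by precomposing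
  with the bonding map, since that map after the later cone map is \<open>p n\<close>.\<close>

lemma F1_above:
  assumes seq: "is_sequence K X f" and lim: "is_limit L X f U p" and "e > 0" and h: "h \<in> hom L U Y"
    and "Y \<in> Obj K"
  obtains n g where "n \<ge> N" "g \<in> hom K (X n) Y" "approx L e h (Comp L g (p n))"
proof -
  obtain n g where g: "g \<in> hom K (X n) Y" "approx L e h (Comp L g (p n))"
    using F1[OF seq lim assms(5,3) h] by blast
  let ?m = "max n N"
  have s: "seq_map K X f n ?m \<in> hom K (X ?m) (X n)"
    by (rule K.seq_map_in_hom[OF seq]) simp
  have cone: "is_cone L X f U p" using lim by (rule is_limit_cone)
  have "Comp L (Comp K g (seq_map K X f n ?m)) (p ?m) = Comp L g (p n)"
    using L.seq_map_cone[OF is_sequence_K_L[OF seq] cone, of n ?m] seq_map_K_L[OF seq]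
      L.comp_assoc[OF is_coneD(2)[OF cone] hom_K_L[OF s] hom_K_L[OF g(1)]] Comp_eq[OF s g(1)]
    by simp
  then show ?thesis
    using that[of ?m "Comp K g (seq_map K X f n ?m)"] K.comp_in_hom[OF s g(1)] g(2) by simp
qed

text \<open>(F1) replaces maps out of \<open>U\<close> by \<open>K\<close>-maps out of some stage,
  and (F2) pulls approximate equalities on \<open>U\<close> back to a later stage.\<close>

lemma Fraisse_sequence_of_cofinal_projective:
  assumes cof: "cofinal_in K L U" and proj: "projective_in K L U"
    and seq: "is_sequence K X f" and lim: "is_limit L X f U p"
  shows "Fraisse_sequence K X f"
proof -
  have cone: "is_cone L X f U p" using lim by (rule is_limit_cone)
  note p = is_coneD(2)[OF cone]
  note seqL = is_sequence_K_L[OF seq]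
  have "cofinal_seq K X"
    unfolding cofinal_seq_def
  proof
    fix Y
    assume Y: "Y \<in> Obj K"
    then obtain h where "h \<in> hom L U Y" using cof unfolding cofinal_in_def by blast
    from F1[OF seq lim Y _ this, of 1] show "\<exists>n f. f \<in> hom K (X n) Y" by auto
  qed
  moreover have proj_seq: "\<exists>n'\<ge>n. \<exists>g'\<in>hom K (X n') Y.
      approx K \<epsilon> (Comp K e (seq_map K X f n n')) (Comp K g g')"
    if \<epsilon>: "\<epsilon> > 0" and e: "e \<in> hom K (X n) Z" and g: "g \<in> hom K Y Z" for n \<epsilon> Y Z e g
  proof -
    note Y = K.hom_Obj(1)[OF g] and Z = K.hom_Obj(2)[OF g]
    note eL = hom_K_L[OF e] and gL = hom_K_L[OF g]
    \<comment> \<open>\<open>\<delta>\<close> is the closeness on \<open>U\<close> that (F2)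
      converts into \<epsilon>-closeness in the sequence. One half pays for the lift
      \<open>h\<close>, the other for replacing \<open>h\<close> by a \<open>K\<close>-map
      \<open>g'\<close>.\<close>
    from F2[OF Z \<epsilon>] obtain \<delta> where "\<delta> > 0" and \<delta>': "\<forall>X f U p n.
        is_sequence K X f \<longrightarrow> is_limit L X f U p \<longrightarrow>
        (\<forall>g\<in>hom K (X n) Z. \<forall>g'\<in>hom K (X n) Z. approx L \<delta> (Comp L g (p n)) (Comp L g' (p n)) \<longrightarrow>
          (\<exists>n'\<ge>n. approx K \<epsilon> (Comp K g (seq_map K X f n n')) (Comp K g' (seq_map K X f n n'))))"
      by (elim exE conjE)
    note \<delta> = \<delta>'[rule_format, OF seq lim]
    from \<open>\<delta> > 0\<close> have \<delta>2: "\<delta> / 2 > 0" by simp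
    obtain h where h: "h \<in> hom L U Y" "approx L (\<delta> / 2) (Comp L e (p n)) (Comp L g h)"
      using proj Y Z \<delta>2 g L.comp_in_hom[OF p eL] unfolding projective_in_def by metis
    obtain \<eta> where "\<eta> > 0" and \<eta>: "\<And>W a b. a \<in> hom L W Y \<Longrightarrow> b \<in> hom L W Y \<Longrightarrow> approx L \<eta> a b \<Longrightarrow>
        approx L (\<delta> / 2) (Comp L g a) (Comp L g b)"
      using L.postcomp_modulus[OF gL \<delta>2] by metis
    \<comment> \<open>Taking \<open>m \<ge> n\<close> lets \<open>e\<close> be carried to the stage
      of \<open>g'\<close>, as (F2) compares maps out of a single stage.\<close>
    obtain m g' where m: "m \<ge> n" and g': "g' \<in> hom K (X m) Y" "approx L \<eta> h (Comp L g' (p m))"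
      using F1_above[OF seq lim \<open>\<eta> > 0\<close> h(1) Y] by metis
    note g'p = L.comp_in_hom[OF p hom_K_L[OF g'(1)]]
    note s = K.seq_map_in_hom[OF seq m]
    have "approx L \<delta> (Comp L e (p n)) (Comp L g (Comp L g' (p m)))"
      by (rule L.approx_trans_half[OF L.comp_in_hom[OF p eL] L.comp_in_hom[OF h(1) gL]
            L.comp_in_hom[OF g'p gL] h(2) \<eta>[OF h(1) g'p g'(2)]])
    moreover have "Comp L (Comp K e (seq_map K X f n m)) (p m) = Comp L e (p n)"
      using L.seq_map_cone[OF seqL cone m] seq_map_K_L[OF seq] Comp_eq[OF s e]
        L.comp_assoc[OF p hom_K_L[OF s] eL] by simp
    moreover have "Comp L (Comp K g g') (p m) = Comp L g (Comp L g' (p m))"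
      using L.comp_assoc[OF p hom_K_L[OF g'(1)] gL] Comp_eq[OF g'(1) g] by simp
    ultimately obtain n' where n': "n' \<ge> m"
      and app: "approx K \<epsilon> (Comp K (Comp K e (seq_map K X f n m)) (seq_map K X f m n'))
        (Comp K (Comp K g g') (seq_map K X f m n'))"
      using \<delta>[OF K.comp_in_hom[OF s e] K.comp_in_hom[OF g'(1) g]] by auto
    note s' = K.seq_map_in_hom[OF seq n']
    have "approx K \<epsilon> (Comp K e (seq_map K X f n n')) (Comp K g (Comp K g' (seq_map K X f m n')))"
      using app K.comp_assoc[OF s' s e] K.comp_assoc[OF s' g'(1) g] K.seq_map_comp[OF seq m n'] by simp
    then show ?thesis
      using K.comp_in_hom[OF s' g'(1)] m n' le_trans by blast
  qed
  moreover have "absorbing_seq K X f"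
    unfolding absorbing_seq_def
  proof (intro allI impI ballI)
    fix n \<epsilon> Y e
    assume \<epsilon>: "(0::real) < \<epsilon>" and e: "e \<in> hom K Y (X n)"
    \<comment> \<open>Absorption is the projectivity property applied to the identity of
      \<open>X n\<close> and to \<open>e\<close>.\<close>
    obtain n' g where n': "n' \<ge> n" and g: "g \<in> hom K (X n') Y"
      and app: "approx K \<epsilon> (Comp K (Ident K (X n)) (seq_map K X f n n')) (Comp K e g)"
      using proj_seq[OF \<epsilon> K.ident_in_hom[OF is_sequenceD(1)[OF seq]] e] by blast
    note s = K.seq_map_in_hom[OF seq n']
    have "approx K \<epsilon> (Comp K e g) (seq_map K X f n n')"
      using K.approx_sym[OF s K.comp_in_hom[OF g e]] app K.comp_ident_left[OF s] by simp
    with n' g show "\<exists>n'\<ge>n. \<exists>g\<in>hom K (X n') Y. approx K \<epsilon> (Comp K e g) (seq_map K X f n n')"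
      by blast
  qed
  ultimately show ?thesis
    using seq unfolding Fraisse_sequence_def projective_seq_def by blast
qed

lemma cofinal_of_Fraisse_sequence:
  assumes F: "Fraisse_sequence K X f" and lim: "is_limit L X f U p"
  shows "cofinal_in K L U"
  unfolding cofinal_in_def
proof
  fix Y
  assume "Y \<in> Obj K"
  then obtain n g where "g \<in> hom K (X n) Y"
    using F unfolding Fraisse_sequence_def cofinal_seq_def by blast
  then show "\<exists>h. h \<in> hom L U Y"
    using L.comp_in_hom[OF is_coneD(2)[OF is_limit_cone[OF lim]] hom_K_L] by blast
qed

text \<open>(F1) approximates the given map through a stage, the sequence supplies the lift there,
  and precomposing with a cone map does not increase the error.\<close>

lemma projective_of_Fraisse_sequence:
  assumes F: "Fraisse_sequence K X f" and lim: "is_limit L X f U p"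
  shows "projective_in K L U"
  unfolding projective_in_def
proof (intro ballI allI impI)
  fix Z \<epsilon> e Y g
  assume Z: "Z \<in> Obj K" and \<epsilon>: "(0::real) < \<epsilon>" and e: "e \<in> hom L U Z" and Y: "Y \<in> Obj K"
    and g: "g \<in> hom K Y Z"
  have seq: "is_sequence K X f" and proj: "projective_seq K X f"
    using F by (auto simp: Fraisse_sequence_def)
  have cone: "is_cone L X f U p" using lim by (rule is_limit_cone)
  note p = is_coneD(2)[OF cone]
  from \<epsilon> have \<epsilon>2: "\<epsilon> / 2 > 0" by simp
  obtain n e' where e': "e' \<in> hom K (X n) Z" "approx L (\<epsilon> / 2) e (Comp L e' (p n))"
    using F1[OF seq lim Z \<epsilon>2 e] by blast
  obtain m g' where m: "m \<ge> n" and g': "g' \<in> hom K (X m) Y"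
    and app: "approx K (\<epsilon> / 2) (Comp K e' (seq_map K X f n m)) (Comp K g g')"
    using proj Y Z \<epsilon>2 e'(1) g unfolding projective_seq_def by metis
  note s = K.seq_map_in_hom[OF seq m]
  note e's = K.comp_in_hom[OF s e'(1)] and gg' = K.comp_in_hom[OF g' g]
  have "approx L (\<epsilon> / 2) (Comp L (Comp K e' (seq_map K X f n m)) (p m)) (Comp L (Comp K g g') (p m))"
    using L.approx_precomp[OF p hom_K_L[OF e's] hom_K_L[OF gg']] app approx_K_L[OF e's gg'] by simp
  moreover have "Comp L (Comp K e' (seq_map K X f n m)) (p m) = Comp L e' (p n)"
    using L.seq_map_cone[OF is_sequence_K_L[OF seq] cone m] seq_map_K_L[OF seq] Comp_eq[OF s e'(1)]
      L.comp_assoc[OF p hom_K_L[OF s] hom_K_L[OF e'(1)]] by simp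
  moreover have "Comp L (Comp K g g') (p m) = Comp L g (Comp L g' (p m))"
    using L.comp_assoc[OF p hom_K_L[OF g'] hom_K_L[OF g]] Comp_eq[OF g' g] by simp
  ultimately have "approx L (\<epsilon> / 2) (Comp L e' (p n)) (Comp L g (Comp L g' (p m)))"
    by simp
  note L.approx_trans_half[OF e L.comp_in_hom[OF p hom_K_L[OF e'(1)]] _ e'(2) this]
  then show "\<exists>h\<in>hom L U Y. approx L \<epsilon> e (Comp L g h)"
    using L.comp_in_hom[OF p hom_K_L[OF g']] L.comp_in_hom[OF _ hom_K_L[OF g]] by blast
qed

section \<open>From projectivity over \<open>K\<close> to projectivity over \<open>L\<close>\<close>

text \<open>Lifting successively along the bonding maps, with the tolerances of
  \<open>approximate_cone\<close>, gives an approximate cone from \<open>U\<close> whose entry at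
  \<open>n\<close> is \<open>h\<close> itself.\<close>

lemma projective_lift_to_limit:
  assumes proj: "projective_in K L U" and seq: "is_sequence K Y g" and lim: "is_limit L Y g V q"
    and h: "h \<in> hom L U (Y n)" and "e > 0"
  shows "\<exists>u\<in>hom L U V. approx L e h (Comp L (q n) u)"
proof -
  note seqL = is_sequence_K_L[OF seq]
  note gK = is_sequenceD(2)[OF seq] and gL = is_sequenceD(2)[OF seqL]
  let ?s = "seq_map L Y g"
  obtain \<delta> where \<delta>': "\<forall>j. \<delta> j > 0" "\<forall>W h. (\<forall>j. h j \<in> hom L W (Y j)) \<longrightarrow>
      (\<forall>j. approx L (\<delta> j) (h j) (Comp L (g j) (h (Suc j)))) \<longrightarrow>
      (\<exists>u\<in>hom L W V. \<forall>j. approx L e (h j) (Comp L (q j) u))"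
    using L.approximate_cone[OF L1_complete seqL lim \<open>e > 0\<close>] by (elim exE conjE)
  note \<delta> = \<delta>'[rule_format]
  \<comment> \<open>Up to level \<open>n\<close> the entries are forced to be composites of
    \<open>h\<close>, so the cone is exact there. Beyond \<open>n\<close> the second clause is
    vacuous and projectivity supplies the next entry.\<close>
  let ?P = "\<lambda>j x. x \<in> hom L U (Y j) \<and> (j \<le> n \<longrightarrow> x = Comp L (?s j n) h)"
  let ?Q = "\<lambda>j x y. approx L (\<delta> j) x (Comp L (g j) y)"
  have s_h: "Comp L (?s j n) h \<in> hom L U (Y j)" if "j \<le> n" for j
    by (rule L.comp_in_hom[OF h L.seq_map_in_hom[OF seqL that]])
  have "\<exists>y. ?P (Suc j) y \<and> ?Q j x y" if "?P j x" for x j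
  proof (cases "Suc j \<le> n")
    case True
    have "Comp L (g j) (Comp L (?s (Suc j) n) h) = Comp L (?s j n) h"
      using L.comp_assoc[OF h L.seq_map_in_hom[OF seqL True] gL]
        L.seq_map_comp[OF seqL _ True, of j] L.seq_map_step[OF seqL] by simp
    then show ?thesis
      using True that s_h L.approx_refl[OF s_h \<delta>(1), of j j] by auto
  next
    case False
    then show ?thesis
      using that proj gK is_sequenceD(1)[OF seq] \<delta>(1) unfolding projective_in_def by metis
  qed
  moreover have "\<exists>x. ?P 0 x" using s_h by auto
  ultimately obtain k where k: "\<And>j. ?P j (k j)" "\<And>j. ?Q j (k j) (k (Suc j))"
    using dependent_nat_choice[of ?P ?Q] by blast
  have "k n = h"
    using k(1)[of n] L.comp_ident_left[OF h] by (simp add: L.seq_map_self)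
  moreover have "\<exists>u\<in>hom L U V. \<forall>j. approx L e (k j) (Comp L (q j) u)"
    using \<delta>'(2) k by blast
  ultimately show ?thesis by auto
qed

lemma cofinal_in_L:
  assumes cof: "cofinal_in K L U" and proj: "projective_in K L U"
  shows "cofinal_in L L U"
  unfolding cofinal_in_def
proof
  fix V
  assume "V \<in> Obj L"
  then obtain Y g q where V: "is_sequence K Y g" "is_limit L Y g V q"
    using L2 by blast
  obtain h where "h \<in> hom L U (Y 0)"
    using cof is_sequenceD(1)[OF V(1)] unfolding cofinal_in_def by blast
  \<comment> \<open>Only the existence of a lift matters; the tolerance 1 is arbitrary.\<close>
  from projective_lift_to_limit[OF proj V this, of 1] show "\<exists>f. f \<in> hom L U V" by auto
qed

text \<open>(C) reduces closeness of maps into \<open>Z\<close> to closeness after one cone map, and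
  (F1) replaces \<open>g\<close> followed by that cone map by a \<open>K\<close>-map
  \<open>g'\<close> out of a stage of \<open>Y\<close>. Projectivity over \<open>K\<close> lifts
  along \<open>g'\<close>, and the lift is then extended to the limit \<open>Y\<close>.\<close>

lemma projective_in_L:
  assumes proj: "projective_in K L U"
  shows "projective_in L L U"
  unfolding projective_in_def
proof (intro ballI allI impI)
  fix Z \<epsilon> e Y g
  assume Z: "Z \<in> Obj L" and \<epsilon>: "(0::real) < \<epsilon>" and e: "e \<in> hom L U Z" and Y: "Y \<in> Obj L"
    and g: "g \<in> hom L Y Z"
  obtain A a p where A: "is_sequence K A a" "is_limit L A a Z p" using L2[OF Z] by blast
  obtain B b q where B: "is_sequence K B b" "is_limit L B b Y q" using L2[OF Y] by blast
  note p = is_coneD(2)[OF is_limit_cone[OF A(2)]] and q = is_coneD(2)[OF is_limit_cone[OF B(2)]]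
  from C[OF A \<epsilon>] obtain n \<delta> where "\<delta> > 0" and \<delta>': "\<forall>W\<in>Obj L. \<forall>h\<in>hom L W Z. \<forall>h'\<in>hom L W Z.
      approx L \<delta> (Comp L (p n) h) (Comp L (p n) h') \<longrightarrow> approx L \<epsilon> h h'"
    by (elim exE conjE)
  note \<delta> = \<delta>'[rule_format, OF L.hom_Obj(1)]
  \<comment> \<open>Half of \<open>\<delta>\<close> pays for replacing \<open>g\<close> by
    \<open>g'\<close>; the quarters pay for the lift \<open>k\<close> and for its extension
    \<open>u\<close>.\<close>
  from \<open>\<delta> > 0\<close> have \<delta>2: "\<delta> / 2 > 0" and \<delta>4: "\<delta> / 2 / 2 > 0" by auto
  obtain m g' where g': "g' \<in> hom K (B m) (A n)" "approx L (\<delta> / 2) (Comp L (p n) g) (Comp L g' (q m))"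
    using F1[OF B is_sequenceD(1)[OF A(1)] \<delta>2 L.comp_in_hom[OF g p]] by blast
  note g'L = hom_K_L[OF g'(1)]
  obtain k where k: "k \<in> hom L U (B m)" "approx L (\<delta> / 2 / 2) (Comp L (p n) e) (Comp L g' k)"
    using proj is_sequenceD(1)[OF A(1)] is_sequenceD(1)[OF B(1)] \<delta>4 g'(1) L.comp_in_hom[OF e p]
    unfolding projective_in_def by metis
  obtain \<eta> where "\<eta> > 0" and \<eta>: "\<And>W x y. x \<in> hom L W (B m) \<Longrightarrow> y \<in> hom L W (B m) \<Longrightarrow> approx L \<eta> x y \<Longrightarrow>
      approx L (\<delta> / 2 / 2) (Comp L g' x) (Comp L g' y)"
    using L.postcomp_modulus[OF g'L \<delta>4] by metis
  obtain u where u: "u \<in> hom L U Y" "approx L \<eta> k (Comp L (q m) u)"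
    using projective_lift_to_limit[OF proj B k(1) \<open>\<eta> > 0\<close>] by blast
  note qu = L.comp_in_hom[OF u(1) q]
  note pe = L.comp_in_hom[OF e p] and g'qu = L.comp_in_hom[OF qu g'L] and gu = L.comp_in_hom[OF u(1) g]
  note pgu = L.comp_in_hom[OF gu p]
  have 1: "approx L (\<delta> / 2) (Comp L (p n) e) (Comp L g' (Comp L (q m) u))"
    by (rule L.approx_trans_half[OF pe L.comp_in_hom[OF k(1) g'L] g'qu k(2) \<eta>[OF k(1) qu u(2)]])
  have "approx L (\<delta> / 2) (Comp L (Comp L (p n) g) u) (Comp L (Comp L g' (q m)) u)"
    by (rule L.approx_precomp[OF u(1) L.comp_in_hom[OF g p] L.comp_in_hom[OF q g'L] g'(2)])
  then have "approx L (\<delta> / 2) (Comp L (p n) (Comp L g u)) (Comp L g' (Comp L (q m) u))"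
    using L.comp_assoc[OF u(1) g p] L.comp_assoc[OF u(1) q g'L] by simp
  then have "approx L \<delta> (Comp L (p n) e) (Comp L (p n) (Comp L g u))"
    using 1 L.approx_sym[OF pgu g'qu] L.approx_trans_half[OF pe g'qu pgu] by blast
  with u(1) show "\<exists>h\<in>hom L U Y. approx L \<epsilon> e (Comp L g h)"
    using \<delta>[OF e e gu] by blast
qed

section \<open>Homogeneity, Fraisse objects and uniqueness\<close>

text \<open>Lift \<open>f\<close> along \<open>g\<close> to an endomorphism of \<open>U\<close>,
  then replace it by a nearby automorphism. As \<open>U\<close> may lie outside \<open>K\<close>,
  the lift uses projectivity in \<open>L\<close>.\<close>

lemma homogeneous_of_projective:
  assumes "projective_in K L U"
  shows "homogeneous_in K L U"
  unfolding homogeneous_in_def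
proof (intro ballI allI impI)
  fix X \<epsilon> f g
  assume X: "X \<in> Obj K" and \<epsilon>: "(0::real) < \<epsilon>" and f: "f \<in> hom L U X" and g: "g \<in> hom L U X"
  note proj = projective_in_L[OF assms]
  from \<epsilon> have \<epsilon>2: "\<epsilon> / 2 > 0" by simp
  obtain h0 where h0: "h0 \<in> hom L U U" "approx L (\<epsilon> / 2) f (Comp L g h0)"
    using proj f g \<epsilon>2 L.hom_Obj[OF f] unfolding projective_in_def by metis
  obtain d where "d > 0" and d: "\<And>W a b. a \<in> hom L W U \<Longrightarrow> b \<in> hom L W U \<Longrightarrow> approx L d a b \<Longrightarrow>
      approx L (\<epsilon> / 2) (Comp L g a) (Comp L g b)"
    using L.postcomp_modulus[OF g \<epsilon>2] by metis
  obtain h where h: "is_iso L h U U" "approx L d h0 h"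
    using L.projective_approx_iso[OF L1_complete proj proj h0(1) \<open>d > 0\<close>] by blast
  then have hU: "h \<in> hom L U U" by (simp add: is_iso_def)
  have "approx L \<epsilon> f (Comp L g h)"
    by (rule L.approx_trans_half[OF f L.comp_in_hom[OF h0(1) g] L.comp_in_hom[OF hU g] h0(2)
          d[OF h0(1) hU h(2)]])
  with h(1) show "\<exists>h. automorphism L U h \<and> approx L \<epsilon> f (Comp L g h)"
    by (auto simp: automorphism_def)
qed

text \<open>Cofinality gives some map \<open>h0\<close> to \<open>Y\<close>; homogeneity corrects it
  by an automorphism so that its composite with \<open>g\<close> approximates
  \<open>f\<close>.\<close>

lemma projective_of_homogeneous:
  assumes cof: "cofinal_in K L U" and hom: "homogeneous_in K L U"
  shows "projective_in K L U"
  unfolding projective_in_def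
proof (intro ballI allI impI)
  fix X \<epsilon> f Y g
  assume X: "X \<in> Obj K" and \<epsilon>: "(0::real) < \<epsilon>" and f: "f \<in> hom L U X" and Y: "Y \<in> Obj K"
    and g: "g \<in> hom K Y X"
  obtain h0 where h0: "h0 \<in> hom L U Y" using cof Y unfolding cofinal_in_def by blast
  obtain a where a: "automorphism L U a" "approx L \<epsilon> f (Comp L (Comp L g h0) a)"
    using hom X \<epsilon> f L.comp_in_hom[OF h0 hom_K_L[OF g]] unfolding homogeneous_in_def by metis
  then have aU: "a \<in> hom L U U" by (simp add: automorphism_def is_iso_def)
  show "\<exists>h\<in>hom L U Y. approx L \<epsilon> f (Comp L g h)"
    using a(2) L.comp_assoc[OF aU h0 hom_K_L[OF g]] L.comp_in_hom[OF aU h0] by auto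
qed

text \<open>From \<open>L\<close> to \<open>K\<close> this is restriction to fewer objects and maps;
  the converse rests on \<open>cofinal_in_L\<close> and \<open>projective_in_L\<close>.\<close>

lemma Fraisse_object_iff:
  assumes "U \<in> Obj L"
  shows "Fraisse_object L U \<longleftrightarrow> cofinal_in K L U \<and> projective_in K L U"
proof
  assume F: "Fraisse_object L U"
  then have "cofinal_in K L U"
    using Obj_subset unfolding Fraisse_object_def cofinal_in_def by blast
  moreover have "projective_in K L U"
    using F Obj_subset hom_K_L unfolding Fraisse_object_def projective_in_def by blast
  ultimately show "cofinal_in K L U \<and> projective_in K L U" ..
next
  assume "cofinal_in K L U \<and> projective_in K L U"
  then show "Fraisse_object L U"
    using assms cofinal_in_L projective_in_L by (simp add: Fraisse_object_def)
qed

text \<open>Cofinality in \<open>L\<close> provides a map from \<open>U\<close> to \<open>V\<close>,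
  and any such map is approximated by isomorphisms.\<close>

lemma Fraisse_object_unique:
  assumes "Fraisse_object L U" "Fraisse_object L V"
  shows "isomorphic L U V"
proof -
  obtain h where "h \<in> hom L U V"
    using assms by (auto simp: Fraisse_object_def cofinal_in_def)
  moreover have "projective_in L L U" "projective_in L L V"
    using assms by (auto simp: Fraisse_object_def)
  ultimately show ?thesis
    using L.projective_approx_iso[OF L1_complete, of U V h 1] by (auto simp: isomorphic_def)
qed

text \<open>For the converse, (L2) presents \<open>U\<close> as a limit of some
  \<open>K\<close>-sequence, and every such sequence is Fraisse.\<close>

lemma limit_of_Fraisse_sequence_iff:
  assumes "U \<in> Obj L"
  shows "(\<exists>X f p. Fraisse_sequence K X f \<and> is_limit L X f U p) \<longleftrightarrow> cofinal_in K L U \<and> projective_in K L U"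
proof
  assume "\<exists>X f p. Fraisse_sequence K X f \<and> is_limit L X f U p"
  then show "cofinal_in K L U \<and> projective_in K L U"
    using cofinal_of_Fraisse_sequence projective_of_Fraisse_sequence by blast
next
  assume "cofinal_in K L U \<and> projective_in K L U"
  then show "\<exists>X f p. Fraisse_sequence K X f \<and> is_limit L X f U p"
    using L2[OF assms] Fraisse_sequence_of_cofinal_projective[of U] by blast
qed

end

theorem theorem4p15:
  fixes K L :: "('o, 'm) mucat"
  assumes "free_completion K L"
  shows
    "(\<forall>U\<in>Obj L.
        ((\<exists>X f p. Fraisse_sequence K X f \<and> is_limit L X f U p)
           \<longleftrightarrow> cofinal_in K L U \<and> projective_in K L U) \<and>
        (cofinal_in K L U \<and> projective_in K L U
           \<longleftrightarrow> cofinal_in K L U \<and> homogeneous_in K L U) \<and>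
        (cofinal_in K L U \<and> homogeneous_in K L U
           \<longleftrightarrow> Fraisse_object L U)) \<and>
     (\<forall>U\<in>Obj L. \<forall>V\<in>Obj L.
        Fraisse_object L U \<and> Fraisse_object L V \<longrightarrow> isomorphic L U V) \<and>
     (\<forall>U\<in>Obj L. Fraisse_object L U \<longrightarrow>
        (\<forall>X f p. is_sequence K X f \<and> is_limit L X f U p \<longrightarrow> Fraisse_sequence K X f))"
proof -
  interpret free_completion K L by (rule assms)
  have hom_iff: "cofinal_in K L U \<and> projective_in K L U \<longleftrightarrow> cofinal_in K L U \<and> homogeneous_in K L U" for U
    using homogeneous_of_projective projective_of_homogeneous by blast
  show ?thesis
  proof (intro conjI ballI allI impI; (elim conjE)?)
    fix U
    assume U: "U \<in> Obj L"
    show "(\<exists>X f p. Fraisse_sequence K X f \<and> is_limit L X f U p)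
        \<longleftrightarrow> cofinal_in K L U \<and> projective_in K L U"
      by (rule limit_of_Fraisse_sequence_iff[OF U])
    show "cofinal_in K L U \<and> projective_in K L U \<longleftrightarrow> cofinal_in K L U \<and> homogeneous_in K L U"
      by (rule hom_iff)
    show "cofinal_in K L U \<and> homogeneous_in K L U \<longleftrightarrow> Fraisse_object L U"
      using hom_iff Fraisse_object_iff[OF U] by simp
  next
    fix U V
    assume "Fraisse_object L U" "Fraisse_object L V"
    then show "isomorphic L U V" by (rule Fraisse_object_unique)
  next
    fix U X f p
    assume "U \<in> Obj L" "Fraisse_object L U" "is_sequence K X f" "is_limit L X f U p"
    then show "Fraisse_sequence K X f"
      using Fraisse_object_iff Fraisse_sequence_of_cofinal_projective by blast
  qed
qed

end
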